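(* Let $k\ge0$, $p\ge1$, and let $T$ be a unilateral weighted shift with weight sequence $0_k\oplus\{\alpha_n\}_{n\ge1}$, where $\{|\alpha_n|\}$ is a $p$-periodic sequence of nonzero numbers. Then the following are equivalent: (i) $\mathcal S(T,T^* )$ is an SI semigroup. (ii) $T^p=0_k\oplus U$ with $U$ an isometry. (iii) $\mathcal S(T,T^* )$ is simple.
   Context: For an orthonormal basis $\{e_n\}_{n\ge1}$ of a Hilbert space $\mathcal H$, the weighted shift with bounded complex weights $\{\beta_n\}$ is the operator with $Te_n=\beta_ne_{n+1}$, $n\ge1$. The sequence $0_k\oplus\{\alpha_n\}$ consists of $k$ zeros followed by $\alpha_1,\alpha_2,\dots$. $\{|\alpha_n|\}$ is $p$-periodic if $|\alpha_{n+p}|=|\alpha_n|$ for all $n\ge1$. In (ii), the direct sum is with respect to $\mathcal H=\operatorname{span}\{e_1,\dots,e_k\}\oplus\overline{\operatorname{span}}\{e_n:n>k\}$, and $0_k$ is the zero operator on the first summand (absent if $k=0$). $\mathcal S(T,T^* )$ is the multiplicative semigroup of all finite nonempty products of $T$ and $T^*$. An ideal of a semigroup $\mathcal S$ is a nonempty subset $J\subset\mathcal S$ with $XA,AX\in J$ for $A\in J$, $X\in\mathcal S$. $\mathcal S$ is simple if its only ideal is $\mathcal S$ itself. $\mathcal S$ is an SI (selfadjoint-ideal) semigroup if every ideal $J$ of $\mathcal S$ satisfies $J^*=\{A^*:A\in J\}\subset J$. *)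

theory Defs
  imports "HOL-Analysis.Analysis"
begin

text \<open>Complex Hilbert spaces. The inner product is linear in its first argument.\<close>

class complex_inner = real_normed_vector +
  fixes scaleC :: "complex \<Rightarrow> 'a \<Rightarrow> 'a" (infixr "*\<^sub>C" 75)
    and cinner :: "'a \<Rightarrow> 'a \<Rightarrow> complex"
  assumes scaleC_add_right: "c *\<^sub>C (x + y) = c *\<^sub>C x + c *\<^sub>C y"
    and scaleC_add_left: "(c + d) *\<^sub>C x = c *\<^sub>C x + d *\<^sub>C x"
    and scaleC_scaleC: "c *\<^sub>C (d *\<^sub>C x) = (c * d) *\<^sub>C x"
    and scaleC_one: "1 *\<^sub>C x = x"
    and scaleR_scaleC: "r *\<^sub>R x = complex_of_real r *\<^sub>C x"
    and cinner_commute: "cinner x y = cnj (cinner y x)"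
    and cinner_add_left: "cinner (x + y) z = cinner x z + cinner y z"
    and cinner_scaleC_left: "cinner (c *\<^sub>C x) y = c * cinner x y"
    and cinner_self_nonneg: "0 \<le> Re (cinner x x)"
    and cinner_self_eq_zero_iff: "cinner x x = 0 \<longleftrightarrow> x = 0"
    and norm_eq_sqrt_cinner: "norm x = sqrt (Re (cinner x x))"

class complex_hilbert = complex_inner + complete_space

definition bounded_clinear :: "('a::complex_inner \<Rightarrow> 'a) \<Rightarrow> bool" where
  "bounded_clinear T \<longleftrightarrow>
     Vector_Spaces.linear scaleC scaleC T \<and> (\<exists>K. \<forall>x. norm (T x) \<le> norm x * K)"

text \<open>The description is unique whenever such a map exists, hence well defined for every
  bounded operator on a Hilbert space.\<close>

definition cadjoint :: "('a::complex_hilbert \<Rightarrow> 'a) \<Rightarrow> 'a \<Rightarrow> 'a" where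
  "cadjoint T = (THE S. \<forall>x y. cinner (T x) y = cinner x (S y))"

definition closed_cspan :: "'a::complex_inner set \<Rightarrow> 'a set" where
  "closed_cspan B = closure (module.span scaleC B)"

definition orthonormal_basis :: "(nat \<Rightarrow> 'a::complex_hilbert) \<Rightarrow> bool" where
  "orthonormal_basis e \<longleftrightarrow>
     (\<forall>m n. cinner (e m) (e n) = (if m = n then 1 else 0)) \<and> closed_cspan (range e) = UNIV"

text \<open>Sequences are indexed from \<open>0\<close>: \<open>e n\<close>, \<open>\<beta> n\<close>, \<open>\<alpha> n\<close> stand for
  the members with index \<open>n + 1\<close> of the usual enumeration from \<open>1\<close>.\<close>

definition weighted_shift ::
  "(nat \<Rightarrow> 'a::complex_hilbert) \<Rightarrow> (nat \<Rightarrow> complex) \<Rightarrow> ('a \<Rightarrow> 'a) \<Rightarrow> bool" where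
  "weighted_shift e \<beta> T \<longleftrightarrow>
     orthonormal_basis e \<and> bounded (range \<beta>) \<and> bounded_clinear T \<and>
     (\<forall>n. T (e n) = \<beta> n *\<^sub>C e (Suc n))"

definition prepend_zeros :: "nat \<Rightarrow> (nat \<Rightarrow> complex) \<Rightarrow> nat \<Rightarrow> complex" where
  "prepend_zeros k \<alpha> n = (if n < k then 0 else \<alpha> (n - k))"

definition periodic_seq :: "nat \<Rightarrow> (nat \<Rightarrow> 'b) \<Rightarrow> bool" where
  "periodic_seq p s \<longleftrightarrow> (\<forall>n. s (n + p) = s n)"

definition isometry_on_subspace :: "'a::complex_inner set \<Rightarrow> ('a \<Rightarrow> 'a) \<Rightarrow> bool" where
  "isometry_on_subspace N U \<longleftrightarrow>
     (\<forall>x\<in>N. U x \<in> N) \<and>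
     (\<forall>x\<in>N. \<forall>y\<in>N. U (x + y) = U x + U y) \<and>
     (\<forall>c. \<forall>x\<in>N. U (c *\<^sub>C x) = c *\<^sub>C U x) \<and>
     (\<forall>x\<in>N. norm (U x) = norm x)"

text \<open>\<open>C = A \<oplus> B\<close> with respect to the decomposition of the space as \<open>M \<oplus> N\<close>;
  only the values of \<open>A\<close> on \<open>M\<close> and of \<open>B\<close> on \<open>N\<close> matter.\<close>

definition is_direct_sum ::
  "'a::complex_inner set \<Rightarrow> 'a set \<Rightarrow> ('a \<Rightarrow> 'a) \<Rightarrow> ('a \<Rightarrow> 'a) \<Rightarrow> ('a \<Rightarrow> 'a) \<Rightarrow> bool" where
  "is_direct_sum M N A B C \<longleftrightarrow>
     A ` M \<subseteq> M \<and> B ` N \<subseteq> N \<and> (\<forall>x\<in>M. \<forall>y\<in>N. C (x + y) = A x + B y)"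

text \<open>\<open>A = 0\<^sub>k \<oplus> U\<close> with \<open>U\<close> an isometry; for \<open>k = 0\<close> the first summand is \<open>{0}\<close>.\<close>

definition zero_sum_isometry ::
  "(nat \<Rightarrow> 'a::complex_hilbert) \<Rightarrow> nat \<Rightarrow> ('a \<Rightarrow> 'a) \<Rightarrow> bool" where
  "zero_sum_isometry e k A \<longleftrightarrow>
     (\<exists>U. isometry_on_subspace (closed_cspan (e ` {k..})) U \<and>
          is_direct_sum (module.span scaleC (e ` {..<k})) (closed_cspan (e ` {k..})) (\<lambda>_. 0) U A)"

definition op_semigroup :: "('a::complex_hilbert \<Rightarrow> 'a) \<Rightarrow> ('a \<Rightarrow> 'a) set" where
  "op_semigroup T = {foldr (\<circ>) ws id | ws. ws \<noteq> [] \<and> set ws \<subseteq> {T, cadjoint T}}"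

definition semigroup_ideal :: "('a \<Rightarrow> 'a) set \<Rightarrow> ('a \<Rightarrow> 'a) set \<Rightarrow> bool" where
  "semigroup_ideal S J \<longleftrightarrow>
     J \<noteq> {} \<and> J \<subseteq> S \<and> (\<forall>A\<in>J. \<forall>X\<in>S. X \<circ> A \<in> J \<and> A \<circ> X \<in> J)"

definition simple_semigroup :: "('a \<Rightarrow> 'a) set \<Rightarrow> bool" where
  "simple_semigroup S \<longleftrightarrow> (\<forall>J. semigroup_ideal S J \<longrightarrow> J = S)"

definition SI_semigroup :: "('a::complex_hilbert \<Rightarrow> 'a) set \<Rightarrow> bool" where
  "SI_semigroup S \<longleftrightarrow> (\<forall>J. semigroup_ideal S J \<longrightarrow> cadjoint ` J \<subseteq> J)"

end

theory Submission
  imports Defs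
begin

text \<open>
  Rotating the basis vectors \<open>e (k + n)\<close> by phases gives vectors \<open>f n\<close> on which \<open>T\<close> is a shift
  with weights \<open>a n = \<bar>\<alpha> n\<bar>\<close>. Let \<open>c\<close> be the product of \<open>a\<close> over one period; (ii) says \<open>c = 1\<close>.
  A word \<open>A\<close> of length \<open>L\<close> in \<open>T, T\<^sup>*\<close> maps \<open>f (n + v)\<close> to \<open>r n\<close> times \<open>f (n + u)\<close>, where the
  product of \<open>r\<close> over any \<open>p\<close> consecutive indices is \<open>c ^ L\<close>, since every letter contributes \<open>c\<close>.
  If \<open>c = 1\<close>, then \<open>B = T\<^sup>*\<^sup>u A T\<^sup>v\<close> is diagonal and \<open>T\<^sup>*\<^sup>p (T B)\<^sup>p = 0\<^sub>k \<oplus> I\<close>, which is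
  the identity of the semigroup, so every ideal is the whole semigroup.
  Conversely, the SI property puts \<open>T\<^sup>*\<close> into the ideal generated by \<open>T\<close>; thus \<open>T\<^sup>*\<close> is a word
  of some length \<open>L \<ge> 2\<close>, and comparing period products gives \<open>c ^ L = c\<close>, hence \<open>c = 1\<close>.
\<close>

section \<open>Inner product spaces\<close>

interpretation C: vector_space "scaleC :: complex \<Rightarrow> 'a::complex_inner \<Rightarrow> 'a"
  by unfold_locales (simp_all add: scaleC_add_right scaleC_add_left scaleC_scaleC scaleC_one)

lemma cinner_add_right: "cinner x (y + z) = cinner x y + cinner x z"
  by (metis cinner_add_left cinner_commute complex_cnj_add)

lemma cinner_scaleC_right: "cinner x (c *\<^sub>C y) = cnj c * cinner x y"
  by (metis cinner_commute cinner_scaleC_left complex_cnj_mult)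

lemma cinner_zero_left [simp]: "cinner 0 y = 0"
  using cinner_add_left[of 0 0 y] by simp

lemma cinner_zero_right [simp]: "cinner x 0 = 0"
  using cinner_add_right[of x 0 0] by simp

lemma cinner_diff_left: "cinner (x - y) z = cinner x z - cinner y z"
  using cinner_add_left[of "x - y" y z] by simp

lemma cinner_diff_right: "cinner x (y - z) = cinner x y - cinner x z"
  using cinner_add_right[of x "y - z" z] by simp

lemma cinner_sum_left: "cinner (\<Sum>i\<in>F. g i) y = (\<Sum>i\<in>F. cinner (g i) y)"
  by (induction F rule: infinite_finite_induct) (auto simp: cinner_add_left)

lemma cinner_sum_right: "cinner x (\<Sum>i\<in>F. g i) = (\<Sum>i\<in>F. cinner x (g i))"
  by (induction F rule: infinite_finite_induct) (auto simp: cinner_add_right)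

lemma cinner_self: "cinner x x = complex_of_real ((norm x)\<^sup>2)"
proof (rule complex_eqI)
  show "Re (cinner x x) = Re (complex_of_real ((norm x)\<^sup>2))"
    by (simp add: norm_eq_sqrt_cinner cinner_self_nonneg)
  show "Im (cinner x x) = Im (complex_of_real ((norm x)\<^sup>2))"
    using arg_cong[OF cinner_commute[of x x], of Im] by simp
qed

lemma cinner_eqI_left:
  assumes "\<And>x. cinner x y = cinner x z"
  shows "y = z"
  using assms[of "y - z"] cinner_self_eq_zero_iff[of "y - z"] by (simp add: cinner_diff_right)

lemma cinner_eqI_right:
  assumes "\<And>x. cinner y x = cinner z x"
  shows "y = z"
  using assms[of "y - z"] cinner_self_eq_zero_iff[of "y - z"] by (simp add: cinner_diff_left)

lemma of_real_cmod_square: "(complex_of_real (cmod z))\<^sup>2 = z * cnj z"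
  using complex_norm_square[of z] by simp

lemma norm_scaleC: "norm (c *\<^sub>C x) = cmod c * norm x"
proof -
  have "complex_of_real ((norm (c *\<^sub>C x))\<^sup>2) = complex_of_real ((cmod c * norm x)\<^sup>2)"
    by (simp only: cinner_self[symmetric] cinner_scaleC_left cinner_scaleC_right)
      (simp add: cinner_self of_real_cmod_square power_mult_distrib mult_ac)
  then have "(norm (c *\<^sub>C x))\<^sup>2 = (cmod c * norm x)\<^sup>2"
    using of_real_eq_iff by blast
  then show ?thesis
    by (simp add: power2_eq_iff_nonneg)
qed

text \<open>Cauchy-Schwarz, from the nonnegative squared norm of \<open>x\<close> minus its
  projection \<open>c *\<^sub>C y\<close> onto the line of \<open>y\<close>.\<close>

lemma cmod_cinner_le: "cmod (cinner x y) \<le> norm x * norm y"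
proof (cases "y = 0")
  case False
  define c where "c = cinner x y / cinner y y"
  have yy: "cinner y y \<noteq> 0"
    using False by (simp add: cinner_self_eq_zero_iff)
  have "cinner (x - c *\<^sub>C y) (x - c *\<^sub>C y) = cinner x x - cnj c * cinner x y"
  proof -
    have "cinner (x - c *\<^sub>C y) y = 0"
      using yy by (simp add: cinner_diff_left cinner_scaleC_left c_def)
    then show ?thesis
      by (simp add: cinner_diff_right[of "x - c *\<^sub>C y"] cinner_scaleC_right)
        (simp add: cinner_diff_left cinner_scaleC_left cinner_commute[of y x] c_def cinner_self)
  qed
  also have "cnj c * cinner x y = complex_of_real ((cmod (cinner x y))\<^sup>2 / (norm y)\<^sup>2)"
    by (simp add: c_def cinner_self of_real_cmod_square mult.commute)
  finally have "complex_of_real ((norm (x - c *\<^sub>C y))\<^sup>2)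
      = complex_of_real ((norm x)\<^sup>2 - (cmod (cinner x y))\<^sup>2 / (norm y)\<^sup>2)"
    by (simp add: cinner_self)
  then have "(norm x)\<^sup>2 - (cmod (cinner x y))\<^sup>2 / (norm y)\<^sup>2 \<ge> 0"
    by (metis of_real_eq_iff zero_le_power2)
  then have "(cmod (cinner x y))\<^sup>2 \<le> (norm x * norm y)\<^sup>2"
    using False by (simp add: field_simps power_mult_distrib)
  then show ?thesis
    by (simp add: power2_le_iff_abs_le)
qed simp

lemma bounded_linear_cinner_left: "bounded_linear (\<lambda>x. cinner x y)"
  by (rule bounded_linear_intro[where K = "norm y"])
    (simp_all add: cinner_add_left scaleR_scaleC cinner_scaleC_left scaleR_conv_of_real
      cmod_cinner_le)

lemma closed_cspan_minimal:
  assumes "C.subspace S" "closed S" "B \<subseteq> S"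
  shows "closed_cspan B \<subseteq> S"
  unfolding closed_cspan_def by (intro closure_minimal C.span_minimal assms)

lemma closed_cspan_superset: "B \<subseteq> closed_cspan B"
  unfolding closed_cspan_def using C.span_superset closure_subset by blast

lemma bounded_clinear_imp_bounded_linear:
  assumes "bounded_clinear T"
  shows "bounded_linear T"
proof -
  interpret Vector_Spaces.linear "scaleC :: complex \<Rightarrow> 'a \<Rightarrow> 'a" "scaleC :: complex \<Rightarrow> 'a \<Rightarrow> 'a" T
    using assms by (simp add: bounded_clinear_def)
  from assms obtain K where "\<And>x. norm (T x) \<le> norm x * K"
    by (auto simp: bounded_clinear_def)
  then show ?thesis
    by (intro bounded_linear_intro[where K = K]) (auto simp: add scaleR_scaleC scale)
qed

section \<open>Adjoints\<close>

text \<open>This identity alone forces both maps to be linear, so words in \<open>T\<close> and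
  \<open>cadjoint T\<close> get their linearity through \<open>adjoint_pair_comp\<close>. The
  definite description in \<open>cadjoint\<close> is evaluated through
  \<open>cadjoint_eqI\<close>.\<close>

definition adjoint_pair :: "('a::complex_inner \<Rightarrow> 'a) \<Rightarrow> ('a \<Rightarrow> 'a) \<Rightarrow> bool" where
  "adjoint_pair A B \<longleftrightarrow> (\<forall>x y. cinner (A x) y = cinner x (B y))"

lemma adjoint_pair_sym: "adjoint_pair A B \<Longrightarrow> adjoint_pair B A"
  unfolding adjoint_pair_def by (metis cinner_commute)

lemma adjoint_pair_comp:
  "adjoint_pair A A' \<Longrightarrow> adjoint_pair B B' \<Longrightarrow> adjoint_pair (A \<circ> B) (B' \<circ> A')"
  by (simp add: adjoint_pair_def)

lemma adjoint_pair_funpow: "adjoint_pair A B \<Longrightarrow> adjoint_pair (A ^^ n) (B ^^ n)"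
proof (induction n)
  case (Suc n)
  then have "adjoint_pair (A \<circ> A ^^ n) (B ^^ n \<circ> B)"
    by (intro adjoint_pair_comp)
  then show ?case
    by (simp only: funpow.simps(2)[of n A] funpow_Suc_right[of n B])
qed (simp add: adjoint_pair_def)

lemma adjoint_pair_unique: "adjoint_pair A B \<Longrightarrow> adjoint_pair A B' \<Longrightarrow> B = B'"
  by (rule ext, rule cinner_eqI_left) (metis adjoint_pair_def)

lemma cadjoint_eqI: "adjoint_pair A B \<Longrightarrow> cadjoint A = B"
  unfolding cadjoint_def adjoint_pair_def[symmetric]
  by (rule the_equality) (auto intro: adjoint_pair_unique)

lemma adjoint_pair_scaleC: "adjoint_pair A B \<Longrightarrow> A (c *\<^sub>C x) = c *\<^sub>C A x"
  by (rule cinner_eqI_right) (simp add: adjoint_pair_def cinner_scaleC_left)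

lemma adjoint_pair_scaleR: "adjoint_pair A B \<Longrightarrow> A (r *\<^sub>R x) = r *\<^sub>R A x"
  by (simp add: scaleR_scaleC adjoint_pair_scaleC)

lemma adjoint_pair_add: "adjoint_pair A B \<Longrightarrow> A (x + y) = A x + A y"
  by (rule cinner_eqI_right) (simp add: adjoint_pair_def cinner_add_left)

lemma adjoint_pair_zero: "adjoint_pair A B \<Longrightarrow> A 0 = 0"
  by (rule cinner_eqI_right) (simp add: adjoint_pair_def)

text \<open>The vectors \<open>x\<close> that do not distinguish \<open>y\<close> from
  \<open>z\<close> form a closed subspace; containing every \<open>e i\<close>, it is the whole
  space.\<close>

lemma orthonormal_basis_eqI:
  assumes e: "orthonormal_basis e" and eq: "\<And>i. cinner (e i) y = cinner (e i) z"
  shows "y = z"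
proof (rule cinner_eqI_left)
  fix x
  let ?S = "{x. cinner x y = cinner x z}"
  have "closed ?S"
    by (intro closed_Collect_eq linear_continuous_on bounded_linear_cinner_left)
  moreover have "C.subspace ?S"
    by (rule C.subspaceI) (auto simp: cinner_add_left cinner_scaleC_left)
  ultimately have "closed_cspan (range e) \<subseteq> ?S"
    using eq by (intro closed_cspan_minimal) auto
  then show "cinner x y = cinner x z"
    using e by (auto simp: orthonormal_basis_def)
qed

text \<open>Moving \<open>A\<close> and \<open>B\<close> across the inner product shows that
  \<open>A'\<close> and \<open>B'\<close> produce equal basis coefficients, so the adjoints agree,
  and these determine \<open>A\<close> and \<open>B\<close>.\<close>

lemma adjoint_pair_eqI:
  assumes e: "orthonormal_basis e" and A: "adjoint_pair A A'" and B: "adjoint_pair B B'"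
    and eq: "\<And>i. A (e i) = B (e i)"
  shows "A = B"
proof -
  have "A' = B'"
    by (rule ext, rule orthonormal_basis_eqI[OF e]) (metis A B adjoint_pair_def eq)
  then show ?thesis
    by (metis A B adjoint_pair_sym adjoint_pair_unique)
qed

text \<open>Riesz representation of \<open>cinner (T x) y\<close> as a functional of
  \<open>x\<close>, made explicit: the representing vector is the sum of its Fourier series, which
  converges because the bound on \<open>T\<close> bounds the partial sums.\<close>

lemma ex_adjoint_pair:
  fixes T :: "'a::complex_hilbert \<Rightarrow> 'a" and e :: "nat \<Rightarrow> 'a"
  assumes e: "orthonormal_basis e" and T: "bounded_clinear T"
  shows "\<exists>S. adjoint_pair T S"
proof -
  interpret Vector_Spaces.linear "scaleC :: complex \<Rightarrow> 'a \<Rightarrow> 'a" "scaleC :: complex \<Rightarrow> 'a \<Rightarrow> 'a" T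
    using T by (simp add: bounded_clinear_def)
  obtain K where K: "\<And>x. norm (T x) \<le> norm x * K"
    using T by (auto simp: bounded_clinear_def)
  have on: "cinner (e m) (e n) = (if m = n then 1 else 0)" for m n
    using e by (auto simp: orthonormal_basis_def)
  have "\<exists>w. \<forall>x. cinner (T x) y = cinner x w" for y
  proof -
    \<comment> \<open>These are the coefficients \<open>cinner w (e n)\<close> that a representing
      vector \<open>w\<close> must have.\<close>
    define z where "z n = cinner y (T (e n))" for n
    define s where "s N = (\<Sum>n<N. z n *\<^sub>C e n)" for N
    define t where "t N = (\<Sum>n<N. (cmod (z n))\<^sup>2)" for N
    have pyth: "(norm (\<Sum>n\<in>F. z n *\<^sub>C e n))\<^sup>2 = (\<Sum>n\<in>F. (cmod (z n))\<^sup>2)" if "finite F" for F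
    proof -
      have "cinner (\<Sum>n\<in>F. z n *\<^sub>C e n) (\<Sum>n\<in>F. z n *\<^sub>C e n)
          = (\<Sum>n\<in>F. \<Sum>m\<in>F. if m = n then z n * cnj (z n) else 0)"
        unfolding cinner_sum_left cinner_sum_right
        by (intro sum.cong refl) (auto simp: cinner_scaleC_left cinner_scaleC_right on)
      also have "\<dots> = complex_of_real (\<Sum>n\<in>F. (cmod (z n))\<^sup>2)"
        using that by (simp add: of_real_cmod_square)
      finally show ?thesis
        unfolding cinner_self of_real_eq_iff .
    qed
    \<comment> \<open>The functional evaluated at its own partial sum is a squared norm;
      Cauchy-Schwarz and the bound \<open>K\<close> then allow one factor \<open>norm (s N)\<close>
      to be cancelled.\<close>
    have "cinner (T (s N)) y = complex_of_real ((norm (s N))\<^sup>2)" for N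
    proof -
      have "cinner (T (e n)) y = cnj (z n)" for n
        unfolding z_def by (rule cinner_commute)
      then have "cinner (T (s N)) y = complex_of_real (t N)"
        by (simp add: s_def t_def sum scale cinner_sum_left cinner_scaleC_left of_real_cmod_square)
      then show ?thesis
        by (simp add: s_def t_def pyth)
    qed
    then have le: "(norm (s N))\<^sup>2 \<le> norm (s N) * K * norm y" for N
      using order_trans[OF cmod_cinner_le[of "T (s N)" y] mult_right_mono[OF K norm_ge_zero]]
      by (metis abs_of_nonneg norm_of_real zero_le_power2)
    have bd: "t N \<le> (K * norm y)\<^sup>2" for N
    proof -
      \<comment> \<open>\<open>K\<close> comes without a sign; the absolute value covers the case of
        a vanishing partial sum.\<close>
      have "norm (s N) \<le> \<bar>K * norm y\<bar>"
      proof (cases "norm (s N) = 0")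
        case False
        then have "norm (s N) \<le> K * norm y"
          using le[of N] by (simp add: power2_eq_square mult.assoc)
        then show ?thesis
          by linarith
      qed simp
      then have "(norm (s N))\<^sup>2 \<le> (K * norm y)\<^sup>2"
        by (simp flip: abs_le_square_iff)
      then show ?thesis
        by (simp add: s_def t_def pyth)
    qed
    have "summable (\<lambda>n. (cmod (z n))\<^sup>2)"
      using bd by (intro summableI_nonneg_bounded[where x = "(K * norm y)\<^sup>2"]) (auto simp: t_def)
    then have "convergent t"
      unfolding t_def summable_iff_convergent .
    then have Ct: "Cauchy t"
      by (rule convergent_Cauchy)
    \<comment> \<open>Orthogonality turns gaps of \<open>s\<close> into gaps of the convergent real
      sequence \<open>t\<close>, which transfers the Cauchy property.\<close>
    have st: "(norm (s M - s N))\<^sup>2 = t M - t N" if "N \<le> M" for M N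
    proof -
      have "s M - s N = (\<Sum>n\<in>{N..<M}. z n *\<^sub>C e n)" "t M - t N = (\<Sum>n\<in>{N..<M}. (cmod (z n))\<^sup>2)"
        using that sum_diff_nat_ivl[of 0 N M] unfolding s_def t_def
        by (simp_all add: lessThan_atLeast0)
      then show ?thesis
        by (simp add: pyth)
    qed
    have "Cauchy s"
    proof (rule metric_CauchyI)
      fix r :: real assume "r > 0"
      then obtain N0 where N0: "\<And>m n. m \<ge> N0 \<Longrightarrow> n \<ge> N0 \<Longrightarrow> \<bar>t m - t n\<bar> < r\<^sup>2"
        using metric_CauchyD[OF Ct, of "r\<^sup>2"] by (auto simp: dist_real_def)
      have "dist (s m) (s n) < r" if "m \<ge> N0" "n \<ge> N0" for m n
      proof -
        have "(norm (s m - s n))\<^sup>2 < r\<^sup>2"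
        proof (cases "n \<le> m")
          case True
          then show ?thesis using st[OF True] N0[OF that] by linarith
        next
          case False
          then show ?thesis using st[of m n] N0[OF that] by (simp add: norm_minus_commute)
        qed
        then show ?thesis
          using \<open>r > 0\<close> by (simp add: dist_norm power_less_imp_less_base)
      qed
      then show "\<exists>M. \<forall>m\<ge>M. \<forall>n\<ge>M. dist (s m) (s n) < r" by blast
    qed
    then obtain w where w: "s \<longlonglongrightarrow> w"
      using Cauchy_convergent convergent_def by blast
    have coeff: "cinner w (e n) = z n" for n
    proof (rule LIMSEQ_unique)
      show "(\<lambda>N. cinner (s N) (e n)) \<longlonglongrightarrow> cinner w (e n)"
        by (rule bounded_linear.tendsto[OF bounded_linear_cinner_left w])
      have "cinner (s N) (e n) = z n" if "N > n" for N
        using that by (simp add: s_def cinner_sum_left cinner_scaleC_left on if_distrib cong: if_cong)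
      then show "(\<lambda>N. cinner (s N) (e n)) \<longlonglongrightarrow> z n"
        by (intro tendsto_eventually eventually_mono[OF eventually_gt_at_top[of n]])
    qed
    let ?S = "{x. cinner (T x) y = cinner x w}"
    have "bounded_linear (\<lambda>x. cinner (T x) y)"
      using bounded_linear_compose[OF bounded_linear_cinner_left
          bounded_clinear_imp_bounded_linear[OF T]] .
    then have "closed ?S"
      by (intro closed_Collect_eq linear_continuous_on bounded_linear_cinner_left)
    moreover have "C.subspace ?S"
      by (rule C.subspaceI) (auto simp: add scale cinner_add_left cinner_scaleC_left)
    moreover have "range e \<subseteq> ?S"
    proof clarify
      fix n
      show "cinner (T (e n)) y = cinner (e n) w"
        using coeff[of n] by (metis cinner_commute z_def)
    qed
    ultimately have "closed_cspan (range e) \<subseteq> ?S"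
      by (intro closed_cspan_minimal)
    then show ?thesis
      using e by (auto simp: orthonormal_basis_def)
  qed
  then show ?thesis
    unfolding adjoint_pair_def by metis
qed

section \<open>The semigroup generated by an operator and its adjoint\<close>

lemma foldr_comp_append: "foldr (\<circ>) (xs @ ys) id = foldr (\<circ>) xs id \<circ> foldr (\<circ>) ys id"
  by (induction xs) auto

lemma op_semigroupI:
  "ws \<noteq> [] \<Longrightarrow> set ws \<subseteq> {T, cadjoint T} \<Longrightarrow> foldr (\<circ>) ws id \<in> op_semigroup T"
  by (auto simp: op_semigroup_def)

lemma op_semigroupE:
  assumes "A \<in> op_semigroup T"
  obtains ws where "A = foldr (\<circ>) ws id" "ws \<noteq> []" "set ws \<subseteq> {T, cadjoint T}"
  using assms by (auto simp: op_semigroup_def)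

lemma generator_in_op_semigroup:
  "T \<in> op_semigroup T" "cadjoint T \<in> op_semigroup T"
  using op_semigroupI[of "[T]" T] op_semigroupI[of "[cadjoint T]" T] by simp_all

lemma semigroup_ideal_funpow_left:
  "semigroup_ideal S J \<Longrightarrow> A \<in> J \<Longrightarrow> X \<in> S \<Longrightarrow> (X ^^ n) \<circ> A \<in> J"
  by (induction n) (auto simp: semigroup_ideal_def comp_assoc)

lemma semigroup_ideal_funpow_right:
  "semigroup_ideal S J \<Longrightarrow> A \<in> J \<Longrightarrow> X \<in> S \<Longrightarrow> A \<circ> (X ^^ n) \<in> J"
proof (induction n)
  case (Suc n)
  then have "(A \<circ> X ^^ n) \<circ> X \<in> J"
    unfolding semigroup_ideal_def by blast
  then show ?case
    by (simp only: funpow_Suc_right comp_assoc)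
qed simp

lemma semigroup_ideal_power:
  assumes "semigroup_ideal S J" "A \<in> J" "n \<ge> 1"
  shows "A ^^ n \<in> J"
proof -
  have "A \<in> S"
    using assms(1,2) by (auto simp: semigroup_ideal_def)
  then have "A ^^ (n - 1) \<circ> A \<in> J"
    using assms by (intro semigroup_ideal_funpow_left)
  then show ?thesis
    using assms(3) by (cases n) (simp_all add: funpow_Suc_right del: funpow.simps)
qed

text \<open>This is the ideal generated by \<open>X\<close>. Membership asks for some representing
  word, since one operator may be given by several words; concatenation keeps the letter
  \<open>X\<close>.\<close>

lemma semigroup_ideal_words_with:
  assumes "X \<in> {T, cadjoint T}"
  shows "semigroup_ideal (op_semigroup T)
    {foldr (\<circ>) ws id |ws. X \<in> set ws \<and> set ws \<subseteq> {T, cadjoint T}}"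
    (is "semigroup_ideal _ ?J")
proof -
  have "foldr (\<circ>) [X] id \<in> ?J"
    using assms by fastforce
  moreover have "?J \<subseteq> op_semigroup T"
    by (auto simp: op_semigroup_def)
  moreover have "B \<circ> A \<in> ?J \<and> A \<circ> B \<in> ?J" if A: "A \<in> ?J" and B: "B \<in> op_semigroup T" for A B
  proof -
    obtain xs where xs: "A = foldr (\<circ>) xs id" "X \<in> set xs" "set xs \<subseteq> {T, cadjoint T}"
      using A by blast
    obtain ys where ys: "B = foldr (\<circ>) ys id" "set ys \<subseteq> {T, cadjoint T}"
      using B by (rule op_semigroupE)
    have "X \<in> set (ys @ xs) \<and> set (ys @ xs) \<subseteq> {T, cadjoint T}"
      "X \<in> set (xs @ ys) \<and> set (xs @ ys) \<subseteq> {T, cadjoint T}"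
      using xs(2,3) ys(2) by simp_all
    then have "foldr (\<circ>) (ys @ xs) id \<in> ?J" "foldr (\<circ>) (xs @ ys) id \<in> ?J"
      by blast+
    then show ?thesis
      unfolding foldr_comp_append xs(1)[symmetric] ys(1)[symmetric] by blast
  qed
  ultimately show ?thesis
    unfolding semigroup_ideal_def by blast
qed

text \<open>Taking adjoints reverses a word and swaps its letters. Recording the length ensures that
  a nonempty word has a nonempty partner.\<close>

lemma word_adjoint_pair:
  assumes "adjoint_pair T (cadjoint T)" "set ws \<subseteq> {T, cadjoint T}"
  shows "\<exists>vs. length vs = length ws \<and> set vs \<subseteq> {T, cadjoint T} \<and>
    adjoint_pair (foldr (\<circ>) ws id) (foldr (\<circ>) vs id)"
  using assms(2)
proof (induction ws)
  case Nil
  show ?case by (simp add: adjoint_pair_def)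
next
  case (Cons X ws)
  from Cons.prems have "set ws \<subseteq> {T, cadjoint T}"
    by simp
  from Cons.IH[OF this] obtain vs where vs: "length vs = length ws" "set vs \<subseteq> {T, cadjoint T}"
    "adjoint_pair (foldr (\<circ>) ws id) (foldr (\<circ>) vs id)"
    by blast
  from Cons.prems have "X \<in> {T, cadjoint T}"
    by simp
  then obtain Y where Y: "Y \<in> {T, cadjoint T}" "adjoint_pair X Y"
    using assms(1) adjoint_pair_sym by blast
  have "adjoint_pair (foldr (\<circ>) (X # ws) id) (foldr (\<circ>) (vs @ [Y]) id)"
    using adjoint_pair_comp[OF Y(2) vs(3)] by (simp only: foldr_comp_append) simp
  moreover have "length (vs @ [Y]) = length (X # ws)" "set (vs @ [Y]) \<subseteq> {T, cadjoint T}"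
    using vs(1,2) Y(1) by simp_all
  ultimately show ?case
    by blast
qed

lemma op_semigroup_adjoint_pair:
  assumes "adjoint_pair T (cadjoint T)" "A \<in> op_semigroup T"
  shows "\<exists>B\<in>op_semigroup T. adjoint_pair A B"
proof -
  obtain ws where ws: "A = foldr (\<circ>) ws id" "ws \<noteq> []" "set ws \<subseteq> {T, cadjoint T}"
    using assms(2) by (rule op_semigroupE)
  then show ?thesis
    using word_adjoint_pair[OF assms(1) ws(3)] by (metis length_0_conv op_semigroupI)
qed

text \<open>The semigroup is closed under adjoints, so its only ideal is selfadjoint.\<close>

lemma simple_imp_SI_semigroup:
  assumes "adjoint_pair T (cadjoint T)" "simple_semigroup (op_semigroup T)"
  shows "SI_semigroup (op_semigroup T)"
  unfolding SI_semigroup_def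
proof (intro allI impI)
  fix J assume "semigroup_ideal (op_semigroup T) J"
  then have "J = op_semigroup T"
    using assms(2) by (auto simp: simple_semigroup_def)
  then show "cadjoint ` J \<subseteq> J"
    using op_semigroup_adjoint_pair[OF assms(1)] cadjoint_eqI by blast
qed

section \<open>Periodic weighted shifts\<close>

text \<open>Sliding the window by one drops \<open>a n\<close> and gains the equal factor
  \<open>a (n + p)\<close>: the product over \<open>p + 1\<close> indices is split at either end and
  \<open>a n\<close> is cancelled.\<close>

lemma prod_period_shift:
  fixes a :: "nat \<Rightarrow> real"
  assumes "\<And>n. a (n + p) = a n" "\<And>n. a n \<noteq> 0"
  shows "(\<Prod>j<p. a (n + j)) = (\<Prod>j<p. a j)"
proof (induction n)
  case (Suc n)
  have "a n * (\<Prod>j<p. a (Suc n + j)) = (\<Prod>j<Suc p. a (n + j))"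
    by (subst prod.lessThan_Suc_shift) simp
  also have "\<dots> = a n * (\<Prod>j<p. a (n + j))"
    by (simp add: assms(1))
  finally show ?case
    using Suc assms(2) by simp
qed simp

locale periodic_weighted_shift =
  fixes e :: "nat \<Rightarrow> 'a::complex_hilbert" and T :: "'a \<Rightarrow> 'a"
    and \<alpha> :: "nat \<Rightarrow> complex" and k p :: nat
  assumes p: "p \<ge> 1"
    and shift: "weighted_shift e (prepend_zeros k \<alpha>) T"
    and periodic: "periodic_seq p (\<lambda>n. cmod (\<alpha> n))"
    and nonzero: "\<And>n. \<alpha> n \<noteq> 0"
begin

section \<open>Coordinates in which the weights are positive\<close>

abbreviation "Tad \<equiv> cadjoint T"

definition "a n = cmod (\<alpha> n)"
definition "c = (\<Prod>j<p. a j)"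
text \<open>Accumulates the arguments of the first \<open>n\<close> weights, so that the step from
  \<open>f n\<close> to \<open>f (Suc n)\<close> absorbs the argument of
  \<open>\<alpha> n\<close>.\<close>

definition "phase n = (\<Prod>j<n. sgn (\<alpha> j))"
definition "f n = phase n *\<^sub>C e (k + n)"

lemma basis: "orthonormal_basis e"
  using shift by (simp add: weighted_shift_def)

lemma clinear: "bounded_clinear T"
  using shift by (simp add: weighted_shift_def)

lemma cinner_basis: "cinner (e m) (e n) = (if m = n then 1 else 0)"
  using basis by (auto simp: orthonormal_basis_def)

lemma T_adjoint_pair: "adjoint_pair T Tad"
  using ex_adjoint_pair[OF basis clinear] cadjoint_eqI by metis

lemma Tad_adjoint_pair: "adjoint_pair Tad T"
  using T_adjoint_pair by (rule adjoint_pair_sym)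

lemma T_basis: "T (e n) = prepend_zeros k \<alpha> n *\<^sub>C e (Suc n)"
  using shift by (simp add: weighted_shift_def)

lemma Tad_basis:
  "Tad (e 0) = 0" "Tad (e (Suc n)) = cnj (prepend_zeros k \<alpha> n) *\<^sub>C e n"
proof -
  have *: "cinner (e i) (Tad x) = cinner (T (e i)) x" for i x
    using T_adjoint_pair by (simp add: adjoint_pair_def)
  show "Tad (e 0) = 0"
    by (rule orthonormal_basis_eqI[OF basis])
      (simp add: * T_basis cinner_scaleC_left cinner_basis)
  show "Tad (e (Suc n)) = cnj (prepend_zeros k \<alpha> n) *\<^sub>C e n"
    by (rule orthonormal_basis_eqI[OF basis])
      (simp add: * T_basis cinner_scaleC_left cinner_scaleC_right cinner_basis)
qed

lemma T_basis_low: "i < k \<Longrightarrow> T (e i) = 0"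
  by (simp add: T_basis prepend_zeros_def)

text \<open>The adjoint lowers the index and meets the weight with index \<open>i - 1\<close>, or
  none if \<open>i = 0\<close>; hence \<open>e k\<close> is annihilated too, although
  \<open>T\<close> does not annihilate it.\<close>

lemma Tad_basis_low: "i \<le> k \<Longrightarrow> Tad (e i) = 0"
  by (cases i) (simp_all add: Tad_basis prepend_zeros_def)

lemma a_pos: "a n > 0"
  by (simp add: a_def nonzero)

lemma prod_a: "(\<Prod>j<p. a (n + j)) = c"
  unfolding c_def
  using periodic a_pos by (intro prod_period_shift) (auto simp: periodic_seq_def a_def nonzero)

lemma c_pos: "c > 0"
  unfolding c_def by (intro prod_pos) (simp add: a_pos)

lemma cmod_phase: "cmod (phase n) = 1"
  by (simp add: phase_def norm_sgn nonzero flip: prod_norm)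

lemma norm_f [simp]: "norm (f n) = 1"
proof -
  have "norm (e i) = 1" for i
    by (simp add: norm_eq_sqrt_cinner cinner_basis)
  then show ?thesis
    by (simp add: f_def norm_scaleC cmod_phase)
qed

lemma f_nonzero: "f n \<noteq> 0"
  by (metis norm_f norm_zero zero_neq_one)

lemma basis_eq_f: "e (k + n) = cnj (phase n) *\<^sub>C f n"
proof -
  have "cnj (phase n) * phase n = 1"
    using of_real_cmod_square[of "phase n"] by (simp add: cmod_phase mult.commute)
  then show ?thesis
    by (simp add: f_def)
qed

lemma T_f: "T (f n) = a n *\<^sub>R f (Suc n)"
proof -
  have "\<alpha> n = complex_of_real (a n) * sgn (\<alpha> n)"
    using nonzero[of n] by (simp add: a_def sgn_div_norm scaleR_conv_of_real)
  then have "phase n * \<alpha> n = complex_of_real (a n) * phase (Suc n)"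
    by (simp add: phase_def)
  then show ?thesis
    by (simp add: f_def adjoint_pair_scaleC[OF T_adjoint_pair] T_basis prepend_zeros_def
        scaleR_scaleC)
qed

lemma Tad_f: "Tad (f (Suc n)) = a n *\<^sub>R f n"
proof -
  have "sgn (\<alpha> n) * cnj (\<alpha> n) = complex_of_real (a n)"
    using nonzero[of n] of_real_cmod_square[of "\<alpha> n"]
    by (simp add: a_def sgn_div_norm scaleR_conv_of_real field_simps power2_eq_square)
  then have "phase (Suc n) * cnj (\<alpha> n) = complex_of_real (a n) * phase n"
    by (simp add: phase_def mult.assoc mult.commute)
  then show ?thesis
    by (simp add: f_def adjoint_pair_scaleC[OF Tad_adjoint_pair] Tad_basis prepend_zeros_def
        scaleR_scaleC)
qed

lemma Tad_f_0: "Tad (f 0) = 0"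
  by (simp add: f_def adjoint_pair_scaleC[OF Tad_adjoint_pair] Tad_basis_low)

section \<open>Powers and words acting on the rotated vectors\<close>

text \<open>Stated for a general shift \<open>X\<close> because it serves both \<open>T\<close> and
  the composition \<open>T \<circ> B\<close> built from an ideal element.\<close>

lemma funpow_shift_f:
  assumes "adjoint_pair X Y" "\<And>n. X (f n) = s n *\<^sub>R f (Suc n)"
  shows "(X ^^ m) (f n) = (\<Prod>j<m. s (n + j)) *\<^sub>R f (n + m)"
  by (induction m) (simp_all add: adjoint_pair_scaleR[OF assms(1)] assms(2))

text \<open>Starting at \<open>n + m\<close> keeps the descent from running past \<open>f 0\<close>.
  The weight is the one that \<open>T ^^ m\<close> picks up on the way from
  \<open>f n\<close>.\<close>

lemma funpow_Tad_f: "(Tad ^^ m) (f (n + m)) = (\<Prod>j<m. a (n + j)) *\<^sub>R f n"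
proof (induction m arbitrary: n)
  case (Suc m)
  have "(Tad ^^ Suc m) (f (n + Suc m)) = Tad ((Tad ^^ m) (f (Suc n + m)))"
    by simp
  also have "\<dots> = (a n * (\<Prod>j<m. a (Suc n + j))) *\<^sub>R f n"
    unfolding Suc.IH adjoint_pair_scaleR[OF Tad_adjoint_pair] Tad_f by simp
  also have "a n * (\<Prod>j<m. a (Suc n + j)) = (\<Prod>j<Suc m. a (n + j))"
    by (subst prod.lessThan_Suc_shift) simp
  finally show ?case .
qed simp

text \<open>Each \<open>T\<close> raises \<open>u\<close> and each \<open>Tad\<close> raises
  \<open>v\<close>; the offset \<open>v\<close> leaves room for every descent. A letter multiplies
  \<open>r\<close> by a translate of \<open>a\<close>, whose product over any period is
  \<open>c\<close>.\<close>

lemma word_acts: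
  assumes "set ws \<subseteq> {T, Tad}"
  shows "\<exists>u v r. (\<forall>n. foldr (\<circ>) ws id (f (n + v)) = r n *\<^sub>R f (n + u)) \<and> (\<forall>n. r n > 0) \<and>
    (\<forall>n. (\<Prod>j<p. r (n + j)) = c ^ length ws)"
  using assms
proof (induction ws)
  case Nil
  show ?case
    by (intro exI[of _ 0] exI[of _ "\<lambda>_. 1"]) simp
next
  case (Cons X ws)
  from Cons.prems have "set ws \<subseteq> {T, Tad}"
    by simp
  from Cons.IH[OF this] obtain u v r where
    act: "\<And>n. foldr (\<circ>) ws id (f (n + v)) = r n *\<^sub>R f (n + u)" and pos: "\<And>n. r n > 0"
    and prd: "\<And>n. (\<Prod>j<p. r (n + j)) = c ^ length ws"
    by blast
  have prod_a': "(\<Prod>j<p. a (n + j + u)) = c" for n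
    using prod_a[of "n + u"] by (simp add: add.assoc add.commute add.left_commute)
  from Cons.prems consider "X = T" | "X = Tad" by auto
  then show ?case
  proof cases
    case 1
    define r' where "r' n = r n * a (n + u)" for n
    have "\<forall>n. foldr (\<circ>) (X # ws) id (f (n + v)) = r' n *\<^sub>R f (n + Suc u)"
      by (simp add: r'_def 1 act adjoint_pair_scaleR[OF T_adjoint_pair] T_f)
    moreover have "\<forall>n. (\<Prod>j<p. r' (n + j)) = c ^ length (X # ws)"
      by (simp add: r'_def prod.distrib prd prod_a')
    moreover have "\<forall>n. r' n > 0"
      by (simp add: r'_def pos a_pos)
    ultimately show ?thesis
      by blast
  next
    case 2
    \<comment> \<open>Raising \<open>v\<close> by one evaluates the shorter word at
      \<open>Suc n\<close>, with image along \<open>f (Suc n + u)\<close>; \<open>Tad\<close> then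
      contributes \<open>a (n + u)\<close>.\<close>
    define r' where "r' n = r (Suc n) * a (n + u)" for n
    have "foldr (\<circ>) (X # ws) id (f (n + Suc v)) = r' n *\<^sub>R f (n + u)" for n
      using act[of "Suc n"] by (simp add: r'_def 2 adjoint_pair_scaleR[OF Tad_adjoint_pair] Tad_f)
    moreover have "(\<Prod>j<p. r' (n + j)) = c ^ length (X # ws)" for n
      using prd[of "Suc n"] by (simp add: r'_def prod.distrib prod_a')
    moreover have "\<forall>n. r' n > 0"
      by (simp add: r'_def pos a_pos)
    ultimately show ?thesis
      by blast
  qed
qed

text \<open>Words are nonempty, and the last letter, which acts first, already annihilates
  \<open>e i\<close>.\<close>

lemma op_semigroup_basis_low:
  assumes "A \<in> op_semigroup T" "i < k"
  shows "A (e i) = 0"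
proof -
  have zero: "foldr (\<circ>) ws id 0 = 0" if "set ws \<subseteq> {T, Tad}" for ws
    using word_adjoint_pair[OF T_adjoint_pair that] adjoint_pair_zero by blast
  obtain ws where ws: "A = foldr (\<circ>) ws id" "ws \<noteq> []" "set ws \<subseteq> {T, Tad}"
    using assms(1) by (rule op_semigroupE)
  obtain vs X where "ws = vs @ [X]"
    using ws(2) by (cases ws rule: rev_cases) auto
  with ws(1,3) have "A = foldr (\<circ>) vs id \<circ> X" "X \<in> {T, Tad}" "set vs \<subseteq> {T, Tad}"
    by (auto simp del: foldr_append simp: foldr_comp_append)
  then show ?thesis
    using assms(2) zero[of vs] T_basis_low Tad_basis_low by auto
qed

text \<open>Fixing every \<open>f n\<close> makes \<open>P\<close> a right identity: on the
  remaining basis vectors both \<open>P\<close> and \<open>Z\<close> vanish.\<close>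

lemma op_semigroup_comp_identity:
  assumes Z: "Z \<in> op_semigroup T" and P: "P \<in> op_semigroup T" and Pf: "\<And>n. P (f n) = f n"
  shows "Z \<circ> P = Z"
proof -
  obtain Z' P' where Z': "adjoint_pair Z Z'" and P': "adjoint_pair P P'"
    using Z P op_semigroup_adjoint_pair[OF T_adjoint_pair] by blast
  show ?thesis
  proof (rule adjoint_pair_eqI[OF basis adjoint_pair_comp[OF Z' P'] Z'])
    fix i
    show "(Z \<circ> P) (e i) = Z (e i)"
    proof (cases "i < k")
      case True
      then show ?thesis
        using op_semigroup_basis_low[OF Z] op_semigroup_basis_low[OF P] adjoint_pair_zero[OF Z']
        by simp
    next
      case False
      then obtain n where "i = k + n"
        using le_Suc_ex not_less by blast
      then show ?thesis
        by (simp add: basis_eq_f adjoint_pair_scaleC[OF P'] Pf)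
    qed
  qed
qed

section \<open>The three conditions in terms of the period product\<close>

lemma simple_if_unit_product:
  assumes c: "c = 1"
  shows "simple_semigroup (op_semigroup T)"
  unfolding simple_semigroup_def
proof (intro allI impI)
  fix J assume J: "semigroup_ideal (op_semigroup T) J"
  then obtain A where A: "A \<in> J" "A \<in> op_semigroup T"
    by (auto simp: semigroup_ideal_def)
  obtain ws where ws: "A = foldr (\<circ>) ws id" "set ws \<subseteq> {T, Tad}"
    using A(2) by (rule op_semigroupE)
  obtain u v r where act: "\<And>n. A (f (n + v)) = r n *\<^sub>R f (n + u)"
    and prd: "\<And>n. (\<Prod>j<p. r (n + j)) = 1"
    using word_acts[OF ws(2)] by (auto simp: c ws(1))
  \<comment> \<open>The weight of \<open>T ^^ m\<close> from \<open>f n\<close> to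
    \<open>f (n + m)\<close>, and equally of \<open>Tad ^^ m\<close> on the way back; its product
    over a period is \<open>c ^ m\<close>.\<close>
  define w where "w m n = (\<Prod>j<m. a (n + j))" for m n
  have prod_w: "(\<Prod>j<p. w m (n + j)) = 1" for m n
  proof -
    have "(\<Prod>j<p. w m (n + j)) = (\<Prod>i<m. \<Prod>j<p. a ((n + i) + j))"
      unfolding w_def by (subst prod.swap) (simp add: ac_simps)
    then show ?thesis
      unfolding prod_a by (simp add: c)
  qed
  \<comment> \<open>The outer powers undo the offsets of \<open>A\<close>, so \<open>B\<close> is
    diagonal on all \<open>f n\<close>. A single diagonal entry need not be 1; only the product over
    a period is.\<close>
  define B where "B = (Tad ^^ u) \<circ> (A \<circ> T ^^ v)"
  have BJ: "B \<in> J"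
    unfolding B_def using J A(1) generator_in_op_semigroup
    by (intro semigroup_ideal_funpow_left semigroup_ideal_funpow_right)
  have op_adj: "\<exists>X'. adjoint_pair X X'" if "X \<in> J" for X
    using J that op_semigroup_adjoint_pair[OF T_adjoint_pair]
    unfolding semigroup_ideal_def by blast
  have Bf: "B (f n) = (w v n * r n * w u n) *\<^sub>R f n" for n
  proof -
    obtain A' where A': "adjoint_pair A A'"
      using op_adj[OF A(1)] by blast
    show ?thesis
      by (simp add: B_def funpow_shift_f[OF T_adjoint_pair T_f] adjoint_pair_scaleR[OF A']
          adjoint_pair_scaleR[OF adjoint_pair_funpow[OF Tad_adjoint_pair]] act funpow_Tad_f w_def)
  qed
  have TBJ: "T \<circ> B \<in> J"
    using J BJ generator_in_op_semigroup unfolding semigroup_ideal_def by blast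
  \<comment> \<open>Interposing \<open>T\<close> moves the index between applications of
    \<open>B\<close>, so the power collects \<open>p\<close> consecutive diagonal entries instead of
    a power of one entry.\<close>
  define P where "P = (Tad ^^ p) \<circ> (T \<circ> B) ^^ p"
  have PJ: "P \<in> J"
    unfolding P_def using J TBJ p generator_in_op_semigroup
    by (intro semigroup_ideal_funpow_left semigroup_ideal_power)
  have Pf: "P (f n) = f n" for n
  proof -
    obtain X' where X': "adjoint_pair (T \<circ> B) X'"
      using op_adj[OF TBJ] by blast
    have "(T \<circ> B) (f n) = (w v n * r n * w u n * a n) *\<^sub>R f (Suc n)" for n
      by (simp add: Bf adjoint_pair_scaleR[OF T_adjoint_pair] T_f)
    then have "((T \<circ> B) ^^ p) (f n)
        = (\<Prod>j<p. w v (n + j) * r (n + j) * w u (n + j) * a (n + j)) *\<^sub>R f (n + p)"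
      by (rule funpow_shift_f[OF X'])
    also have "(\<Prod>j<p. w v (n + j) * r (n + j) * w u (n + j) * a (n + j)) = 1"
      by (simp add: prod.distrib prod_w prd prod_a c)
    finally have "((T \<circ> B) ^^ p) (f n) = f (n + p)"
      by (simp only: scaleR_one)
    then show ?thesis
      by (simp add: P_def funpow_Tad_f prod_a c)
  qed
  have "Z \<in> J" if Z: "Z \<in> op_semigroup T" for Z
  proof -
    have "Z \<circ> P \<in> J" "P \<in> op_semigroup T"
      using J PJ Z by (auto simp: semigroup_ideal_def)
    then show ?thesis
      using op_semigroup_comp_identity[OF Z _ Pf] by simp
  qed
  then show "J = op_semigroup T"
    using J by (auto simp: semigroup_ideal_def)
qed

lemma unit_product_if_SI:
  assumes "SI_semigroup (op_semigroup T)"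
  shows "c = 1"
proof -
  let ?J = "{foldr (\<circ>) ws id |ws. T \<in> set ws \<and> set ws \<subseteq> {T, Tad}}"
  have "cadjoint ` ?J \<subseteq> ?J"
    using assms semigroup_ideal_words_with[of T T] by (auto simp: SI_semigroup_def)
  moreover have "foldr (\<circ>) [T] id \<in> ?J"
    by fastforce
  ultimately have "Tad \<in> ?J"
    by auto
  then obtain ws where ws: "Tad = foldr (\<circ>) ws id" "T \<in> set ws" "set ws \<subseteq> {T, Tad}"
    by blast
  \<comment> \<open>This excludes the word \<open>[T]\<close>, the only word of length one that
    contains \<open>T\<close>; for it the comparison of period products would be void.\<close>
  have "T \<noteq> Tad"
    using T_f[of 0] Tad_f_0 a_pos[of 0] f_nonzero by auto
  then have "length ws \<noteq> 1"
    using ws(1,2) by (auto simp: length_Suc_conv)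
  then have len: "length ws \<ge> 2"
    using ws(2) by (cases ws) (auto simp: Suc_le_eq)
  obtain u v r where act: "\<And>n. Tad (f (n + v)) = r n *\<^sub>R f (n + u)" and pos: "\<And>n. r n > 0"
    and prd: "\<And>n. (\<Prod>j<p. r (n + j)) = c ^ length ws"
    using word_acts[OF ws(3)] by (auto simp flip: ws(1))
  \<comment> \<open>\<open>Suc n\<close> keeps away from \<open>Tad (f 0) = 0\<close>, as
    \<open>v\<close> may be 0. Taking norms compares the weights without relating \<open>u\<close>
    to \<open>v\<close>.\<close>
  have r_eq: "r (Suc n) = a (n + v)" for n
  proof -
    have "r (Suc n) *\<^sub>R f (Suc n + u) = a (n + v) *\<^sub>R f (n + v)"
      using act[of "Suc n"] Tad_f[of "n + v"] by simp
    from arg_cong[OF this, of norm] show ?thesis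
      using pos[of "Suc n"] a_pos[of "n + v"] by simp
  qed
  \<comment> \<open>The window starts at 1 because \<open>r_eq\<close> gives \<open>r\<close> at
    positive indices only.\<close>
  have "c ^ length ws = (\<Prod>j<p. r (1 + j))"
    by (rule prd[symmetric])
  also have "\<dots> = (\<Prod>j<p. a (v + j))"
    by (simp add: r_eq add.commute)
  finally have "c ^ length ws = c"
    by (simp only: prod_a)
  moreover have "length ws = Suc (length ws - 1)"
    using len by simp
  ultimately have "c ^ (length ws - 1) = 1"
    using c_pos by (metis less_irrefl mult_cancel_left2 power_Suc)
  then show ?thesis
    using c_pos len power_eq_iff_eq_base[of "length ws - 1" c 1] by simp
qed

text \<open>\<open>T ^^ p\<close> runs through a full period and so scales each \<open>f n\<close>
  by \<open>c\<close> up to translation. The norm at \<open>f 0\<close> forces \<open>c = 1\<close>;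
  conversely \<open>Tad ^^ p\<close> inverts \<open>T ^^ p\<close> on the span of the upper basis
  vectors.\<close>

lemma zero_sum_isometry_iff: "zero_sum_isometry e k (T ^^ p) \<longleftrightarrow> c = 1"
proof
  let ?N = "closed_cspan (e ` {k..})"
  have Tpf: "(T ^^ p) (f n) = c *\<^sub>R f (n + p)" for n
    using funpow_shift_f[OF T_adjoint_pair T_f] by (simp add: prod_a)
  {
    assume "zero_sum_isometry e k (T ^^ p)"
    then obtain U where iso: "isometry_on_subspace ?N U"
      and sum: "is_direct_sum (C.span (e ` {..<k})) ?N (\<lambda>_. 0) U (T ^^ p)"
      by (auto simp: zero_sum_isometry_def)
    have "e k \<in> ?N"
      using closed_cspan_superset[of "e ` {k..}"] by auto
    then have f0: "f 0 \<in> ?N"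
      by (simp add: f_def phase_def)
    have "(T ^^ p) (0 + f 0) = 0 + U (f 0)"
      using sum f0 C.span_zero unfolding is_direct_sum_def by blast
    moreover have "norm (U (f 0)) = 1"
      using iso f0 by (simp add: isometry_on_subspace_def)
    ultimately show "c = 1"
      using arg_cong[OF Tpf[of 0], of norm] c_pos by simp
  next
    assume c: "c = 1"
    \<comment> \<open>Continuity of the powers carries invariance and norm preservation from the
      span to its closure.\<close>
    have bl: "bounded_linear (T ^^ m)" for m
    proof (induction m)
      case (Suc m)
      then show ?case
        using bounded_linear_compose[OF bounded_clinear_imp_bounded_linear[OF clinear]]
        by (simp add: comp_def)
    qed (simp add: id_def)
    note adj = adjoint_pair_funpow[OF T_adjoint_pair]
    note adj' = adjoint_pair_sym[OF adj]
    note cont = linear_continuous_on[OF bl]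
    have Tpe: "(T ^^ p) (e (k + n)) \<in> C.span (e ` {k..})" for n
    proof -
      have "f (n + p) \<in> C.span (e ` {k..})"
        unfolding f_def by (intro C.span_scale C.span_base) simp
      then show ?thesis
        by (simp add: basis_eq_f adjoint_pair_scaleC[OF adj] Tpf c C.span_scale)
    qed
    have span_range: "(T ^^ p) x \<in> C.span (e ` {k..})" if "x \<in> C.span (e ` {k..})" for x
      using that
    proof (induction rule: C.span_induct_alt)
      case (step d x y)
      then obtain n where "x = e (k + n)"
        using le_Suc_ex by auto
      then show ?case
        using Tpe step by (simp add: adjoint_pair_add[OF adj] adjoint_pair_scaleC[OF adj]
            C.span_add C.span_scale)
    qed (simp add: adjoint_pair_zero[OF adj] C.span_zero)
    have span_fix: "(Tad ^^ p) ((T ^^ p) x) = x" if "x \<in> C.span (e ` {k..})" for x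
      using that
    proof (induction rule: C.span_induct_alt)
      case (step d x y)
      then obtain n where "x = e (k + n)"
        using le_Suc_ex by auto
      then have "(Tad ^^ p) ((T ^^ p) x) = x"
        by (simp add: basis_eq_f adjoint_pair_scaleC[OF adj] adjoint_pair_scaleC[OF adj'] Tpf c
            funpow_Tad_f prod_a)
      then show ?case
        using step by (simp add: adjoint_pair_add[OF adj] adjoint_pair_scaleC[OF adj]
            adjoint_pair_add[OF adj'] adjoint_pair_scaleC[OF adj'])
    qed (simp add: adjoint_pair_zero[OF adj] adjoint_pair_zero[OF adj'])
    have span_norm: "norm ((T ^^ p) x) = norm x" if "x \<in> C.span (e ` {k..})" for x
    proof -
      have "cinner ((T ^^ p) x) ((T ^^ p) x) = cinner x ((Tad ^^ p) ((T ^^ p) x))"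
        using adj[of p] by (simp add: adjoint_pair_def)
      then show ?thesis
        by (simp add: span_fix[OF that] norm_eq_sqrt_cinner)
    qed
    have N_range: "(T ^^ p) x \<in> ?N" if "x \<in> ?N" for x
    proof -
      have "(T ^^ p) ` closure (C.span (e ` {k..})) \<subseteq> closure (C.span (e ` {k..}))"
        using span_range closure_subset
        by (intro image_closure_subset[OF cont closed_closure]) blast
      then show ?thesis
        using that by (auto simp: closed_cspan_def)
    qed
    have N_norm: "norm ((T ^^ p) x) = norm x" if "x \<in> ?N" for x
    proof -
      have "closed {x. norm ((T ^^ p) x) = norm x}"
        by (intro closed_Collect_eq continuous_on_norm cont continuous_on_id)
      then have "closure (C.span (e ` {k..})) \<subseteq> {x. norm ((T ^^ p) x) = norm x}"
        using span_norm by (intro closure_minimal) auto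
      then show ?thesis
        using that by (auto simp: closed_cspan_def)
    qed
    have low: "(T ^^ p) x = 0" if "x \<in> C.span (e ` {..<k})" for x
      using that
    proof (induction rule: C.span_induct_alt)
      case (step d x y)
      \<comment> \<open>Since \<open>p\<close> is positive, one factor \<open>T\<close> can act
        first, and it annihilates the low basis vectors.\<close>
      have "(T ^^ p) x = (T ^^ (p - 1)) (T x)"
        using p by (cases p) (simp_all add: funpow_Suc_right del: funpow.simps)
      then have "(T ^^ p) x = 0"
        using step T_basis_low adjoint_pair_zero[OF adj] by auto
      then show ?case
        using step by (simp add: adjoint_pair_add[OF adj] adjoint_pair_scaleC[OF adj])
    qed (simp add: adjoint_pair_zero[OF adj])
    have "isometry_on_subspace ?N (T ^^ p)"
      unfolding isometry_on_subspace_def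
      using N_range N_norm adjoint_pair_add[OF adj] adjoint_pair_scaleC[OF adj] by blast
    moreover have "is_direct_sum (C.span (e ` {..<k})) ?N (\<lambda>_. 0) (T ^^ p) (T ^^ p)"
      unfolding is_direct_sum_def
      using N_range low adjoint_pair_add[OF adj] by (auto simp: C.span_zero)
    ultimately show "zero_sum_isometry e k (T ^^ p)"
      unfolding zero_sum_isometry_def by blast
  }
qed

end

theorem theorem3p17:
  fixes e :: "nat \<Rightarrow> 'a::complex_hilbert"
    and T :: "'a \<Rightarrow> 'a"
    and \<alpha> :: "nat \<Rightarrow> complex"
    and k p :: nat
  assumes "p \<ge> 1"
    and "weighted_shift e (prepend_zeros k \<alpha>) T"
    and "periodic_seq p (\<lambda>n. cmod (\<alpha> n))"
    and "\<And>n. cmod (\<alpha> n) \<noteq> 0"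
  shows "(SI_semigroup (op_semigroup T) \<longleftrightarrow> zero_sum_isometry e k (T ^^ p)) \<and>
         (zero_sum_isometry e k (T ^^ p) \<longleftrightarrow> simple_semigroup (op_semigroup T))"
proof -
  interpret periodic_weighted_shift e T \<alpha> k p
    using assms by unfold_locales auto
  show ?thesis
    \<comment> \<open>Condition (ii) is \<open>c = 1\<close>, and the cycle simple, SI,
      \<open>c = 1\<close>, simple closes the equivalence.\<close>
    using zero_sum_isometry_iff simple_if_unit_product unit_product_if_SI
      simple_imp_SI_semigroup[OF T_adjoint_pair] by blast
qed

end
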